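(* Consider a $K$-user $M_t\times M_r$ MIMO interference channel with $T$ (possibly dependent) channel extensions. Let $N_t=M_tT$, $N_r=M_rT$ and $N=\min\{N_t,N_r\}$. Suppose the channel diversity order is $L$, i.e. the channel matrices are $H_{ij}=\tau_{ij}^1A_1+\dots+\tau_{ij}^LA_L\in\mathbb{C}^{N_r\times N_t}$ for $1\le i,j\le K$, where $A_1,\dots,A_L\in\mathbb{C}^{N_r\times N_t}$ are fixed linearly independent matrices with $(A_1,\dots,A_L)\in\Psi$. Then for almost all coefficients $(\tau_{ij}^l)_{1\le i,j\le K,\,1\le l\le L}\in\mathbb{C}^{K^2L}$, the DoF tuple $(d_1,\dots,d_K)=(1,1,\dots,1)$ is achievable via a vector space IA scheme only if $$K\le NL+\frac{N^2}{4}.$$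
   Context: $\Psi$ denotes the set of tuples $(A_1,\dots,A_L)$ with $A_\ell\in\mathbb{C}^{N_r\times N_t}$ for which there exist $k_1,\dots,k_L\in\mathbb{C}$ such that $\mathrm{rank}(k_1A_1+\dots+k_LA_L)=\min\{N_r,N_t\}$. The DoF tuple $(1,\dots,1)$ is achievable via a vector space interference alignment (IA) scheme for given channel matrices $(H_{kj})$ if there exist $v_k\in\mathbb{C}^{N_t}$, $u_k\in\mathbb{C}^{N_r}$, $1\le k\le K$, such that $u_k^HH_{kj}v_j=0$ for all $1\le k\neq j\le K$ and $u_k^HH_{kk}v_k\neq0$ for all $1\le k\le K$, where $(\cdot)^H$ is the conjugate transpose. "Almost all coefficients" is with respect to Lebesgue measure on $\mathbb{C}^{K^2L}$. $M_t,M_r,T,K,L$ are positive integers. *)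

theory Defs
  imports "HOL-Analysis.Analysis"
begin

(* Complex N_r x N_t matrices are complex ^ 'nt ^ 'nr with CARD('nr) = N_r rows and
   CARD('nt) = N_t columns. Users and basis matrices are indexed by finite types 'k and 'l
   with CARD('k) = K and CARD('l) = L. *)

(* *\<^sub>R is only the real scaling, so complex scalar multiplication is defined here. *)
definition mat_scale :: "complex \<Rightarrow> complex ^ 'n ^ 'm \<Rightarrow> complex ^ 'n ^ 'm"
  where "mat_scale c A = (\<chi> i j. c * A $ i $ j)"

lemma vector_space_mat_scale: "vector_space mat_scale"
  by unfold_locales (auto simp: mat_scale_def vec_eq_iff algebra_simps)

definition lin_comb :: "('l::finite \<Rightarrow> complex) \<Rightarrow> ('l \<Rightarrow> complex ^ 'n ^ 'm) \<Rightarrow> complex ^ 'n ^ 'm"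
  where "lin_comb c A = (\<Sum>l\<in>UNIV. mat_scale (c l) (A l))"

(* Independence over the complex numbers, of a family: repeated matrices are excluded. *)
definition lin_indep_family :: "('l::finite \<Rightarrow> complex ^ 'n ^ 'm) \<Rightarrow> bool"
  where "lin_indep_family A \<longleftrightarrow> (\<forall>c. lin_comb c A = 0 \<longrightarrow> (\<forall>l. c l = 0))"

lemma lin_indep_family_iff:
  "lin_indep_family A \<longleftrightarrow> inj A \<and> \<not> module.dependent mat_scale (range A)"
proof -
  interpret V: vector_space mat_scale by (rule vector_space_mat_scale)
  have fin: "V.dependent (range A) \<longleftrightarrow>
      (\<exists>u. (\<exists>v\<in>range A. u v \<noteq> 0) \<and> (\<Sum>v\<in>range A. mat_scale (u v) v) = 0)"
    by (rule V.dependent_finite) simp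
  have re: "(\<Sum>v\<in>range A. mat_scale (u v) v) = lin_comb (u \<circ> A) A" if "inj A" for u
    using that by (simp add: lin_comb_def sum.reindex)
  show ?thesis
  proof
    assume L: "lin_indep_family A"
    have inj: "inj A"
    proof (rule injI, rule ccontr)
      fix x y assume xy: "A x = A y" "x \<noteq> y"
      define c :: "_ \<Rightarrow> complex" where "c = (\<lambda>l. if l = x then 1 else if l = y then -1 else 0)"
      have "lin_comb c A = (\<Sum>l\<in>{x,y}. mat_scale (c l) (A l))"
        unfolding lin_comb_def by (rule sum.mono_neutral_right) (auto simp: c_def)
      also have "\<dots> = 0"
        using xy by (simp add: c_def)
      finally have "c x = 0" using L by (simp add: lin_indep_family_def)
      then show False by (simp add: c_def)
    qed
    then show "inj A \<and> \<not> V.dependent (range A)"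
      using L unfolding fin by (auto simp: re lin_indep_family_def)
  next
    assume R: "inj A \<and> \<not> V.dependent (range A)"
    show "lin_indep_family A"
      unfolding lin_indep_family_def
    proof (intro allI impI)
      fix c l assume c: "lin_comb c A = 0"
      have "(c \<circ> inv A) \<circ> A = c" using R by (simp add: fun_eq_iff)
      with re[of "c \<circ> inv A"] c R
      have "(\<Sum>v\<in>range A. mat_scale ((c \<circ> inv A) v) v) = 0" by metis
      with R fin have "(c \<circ> inv A) (A l) = 0" by blast
      then show "c l = 0" using R by simp
    qed
  qed
qed

definition Psi :: "('l::finite \<Rightarrow> complex ^ 'nt ^ 'nr) set"
  where "Psi = {A. \<exists>k. rank (lin_comb k A) = min CARD('nr) CARD('nt)}"

(* channel A \<tau> i j is the matrix from transmitter j to receiver i. *)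
definition channel ::
    "('l::finite \<Rightarrow> complex ^ 'nt ^ 'nr) \<Rightarrow> complex ^ ('k::finite \<times> 'k \<times> 'l) \<Rightarrow> 'k \<Rightarrow> 'k \<Rightarrow> complex ^ 'nt ^ 'nr"
  where "channel A \<tau> i j = lin_comb (\<lambda>l. \<tau> $ (i, j, l)) A"

(* u\<^sup>H w. The inner product of the library on complex vectors is its real part only. *)
definition herm_prod :: "complex ^ 'n \<Rightarrow> complex ^ 'n \<Rightarrow> complex"
  where "herm_prod u w = (\<Sum>i\<in>UNIV. cnj (u $ i) * w $ i)"

(* Achievability of the DoF tuple (1, ..., 1). *)
definition IA_achievable :: "('k \<Rightarrow> 'k \<Rightarrow> complex ^ 'nt ^ 'nr) \<Rightarrow> bool"
  where "IA_achievable H \<longleftrightarrow>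
    (\<exists>(v :: 'k \<Rightarrow> complex ^ 'nt) (u :: 'k \<Rightarrow> complex ^ 'nr).
      (\<forall>k j. k \<noteq> j \<longrightarrow> herm_prod (u k) (H k j *v v j) = 0) \<and>
      (\<forall>k. herm_prod (u k) (H k k *v v k) \<noteq> 0))"

end

theory Submission
  imports Defs
begin

text \<open>
  The bound holds in the stronger form \<open>K < (L + 1) N\<close>. Only the numbers
  \<open>y\<^sub>j\<^sub>l(k) = u\<^sub>k\<^sup>H A\<^sub>l v\<^sub>j\<close> matter: for fixed \<open>j, l\<close> they form a vector in \<open>\<complex>\<^sup>K\<close>, all these
  vectors lie in a space of dimension at most \<open>N\<close>, and alignment says that
  \<open>\<Sum>\<^sub>l \<tau>\<^sub>k\<^sub>j\<^sup>l y\<^sub>j\<^sub>l(k) = 0\<close> for \<open>k \<noteq> j\<close>. Where \<open>y\<^sub>j\<^sub>l(k) \<noteq> 0\<close> for some \<open>l\<close>, this expresses one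
  coefficient through the others, whereas almost every \<open>\<tau>\<close> is not contained in a field
  generated by fewer than \<open>K\<^sup>2 L\<close> numbers. So the supports of the \<open>y\<^sub>j\<close> cannot be large compared
  with the number of parameters needed for the \<open>y\<^sub>j\<^sub>l\<close>. If \<open>K \<ge> (L + 1) N\<close>, then restricting first to a
  densest set of receivers and then to a densest set of transmitters, and choosing a basis
  of the remaining space among the \<open>y\<^sub>j\<^sub>l\<close> greedily, makes the supports too large.
\<close>

subsection \<open>Generated subfields and generic points\<close>

text \<open>The subfield of the complex numbers generated by \<open>X\<close>. Closure under
  \<open>inverse\<close> needs no side condition because \<open>inverse 0 = 0\<close>.\<close>

inductive_set fgen :: "complex set \<Rightarrow> complex set" for X where
  fgen_base: "x \<in> X \<Longrightarrow> x \<in> fgen X"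
| fgen_one: "1 \<in> fgen X"
| fgen_add: "a \<in> fgen X \<Longrightarrow> b \<in> fgen X \<Longrightarrow> a + b \<in> fgen X"
| fgen_uminus: "a \<in> fgen X \<Longrightarrow> - a \<in> fgen X"
| fgen_mult: "a \<in> fgen X \<Longrightarrow> b \<in> fgen X \<Longrightarrow> a * b \<in> fgen X"
| fgen_inverse: "a \<in> fgen X \<Longrightarrow> inverse a \<in> fgen X"

lemma fgen_diff: "a \<in> fgen X \<Longrightarrow> b \<in> fgen X \<Longrightarrow> a - b \<in> fgen X"
  using fgen_add[OF _ fgen_uminus] by (metis diff_conv_add_uminus)

lemma fgen_zero: "0 \<in> fgen X"
  using fgen_diff[OF fgen_one fgen_one] by simp

lemma fgen_divide: "a \<in> fgen X \<Longrightarrow> b \<in> fgen X \<Longrightarrow> a / b \<in> fgen X"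
  unfolding divide_inverse by (intro fgen_mult fgen_inverse)

lemma fgen_sum: "(\<And>i. i \<in> I \<Longrightarrow> f i \<in> fgen X) \<Longrightarrow> sum f I \<in> fgen X"
  by (induction I rule: infinite_finite_induct) (auto intro: fgen_zero fgen_add)

lemma fgen_mono: "X \<subseteq> Y \<Longrightarrow> a \<in> fgen X \<Longrightarrow> a \<in> fgen Y"
  by (rotate_tac, induction rule: fgen.induct) (auto intro: fgen.intros)

text \<open>Codes for rational functions whose constants are all built from 1. Having only countably
  many of them makes a union of null sets over all codes null.\<close>

datatype 'i rexp = RVar 'i | ROne | RAdd "'i rexp" "'i rexp" | RNeg "'i rexp"
  | RMul "'i rexp" "'i rexp" | RInv "'i rexp"

instance rexp :: (countable) countable
  by countable_datatype

primrec reval :: "complex ^ 'i \<Rightarrow> 'i rexp \<Rightarrow> complex" where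
  "reval x (RVar i) = x $ i"
| "reval x ROne = 1"
| "reval x (RAdd s t) = reval x s + reval x t"
| "reval x (RNeg s) = - reval x s"
| "reval x (RMul s t) = reval x s * reval x t"
| "reval x (RInv s) = inverse (reval x s)"

text \<open>Excludes division by zero: the total \<open>inverse\<close> returns 0 there, but it is
  not differentiable at 0.\<close>

primrec rdefined :: "complex ^ 'i \<Rightarrow> 'i rexp \<Rightarrow> bool" where
  "rdefined x (RVar i) \<longleftrightarrow> True"
| "rdefined x ROne \<longleftrightarrow> True"
| "rdefined x (RAdd s t) \<longleftrightarrow> rdefined x s \<and> rdefined x t"
| "rdefined x (RNeg s) \<longleftrightarrow> rdefined x s"
| "rdefined x (RMul s t) \<longleftrightarrow> rdefined x s \<and> rdefined x t"
| "rdefined x (RInv s) \<longleftrightarrow> rdefined x s \<and> reval x s \<noteq> 0"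

lemma fgen_imp_reval:
  assumes "a \<in> fgen X" "X \<subseteq> range (($) x)"
  shows "\<exists>t. rdefined x t \<and> reval x t = a"
  using assms(1)
proof (induction rule: fgen.induct)
  case (fgen_base b)
  then obtain i where "b = x $ i" using assms(2) by auto
  then show ?case by (intro exI[of _ "RVar i"]) auto
next
  case fgen_one
  show ?case by (intro exI[of _ ROne]) auto
next
  case (fgen_add a b)
  then obtain s t where "rdefined x s" "reval x s = a" "rdefined x t" "reval x t = b" by blast
  then show ?case by (intro exI[of _ "RAdd s t"]) auto
next
  case (fgen_uminus a)
  then obtain s where "rdefined x s" "reval x s = a" by blast
  then show ?case by (intro exI[of _ "RNeg s"]) auto
next
  case (fgen_mult a b)
  then obtain s t where "rdefined x s" "reval x s = a" "rdefined x t" "reval x t = b" by blast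
  then show ?case by (intro exI[of _ "RMul s t"]) auto
next
  case (fgen_inverse a)
  then obtain s where s: "rdefined x s" "reval x s = a" by blast
  show ?case
  proof (cases "a = 0")
    \<comment> \<open>No new expression is needed: the code \<open>s\<close> has value 0, which is
      also \<open>inverse 0\<close>.\<close>
    case True
    with s show ?thesis by auto
  next
    case False
    with s show ?thesis by (intro exI[of _ "RInv s"]) auto
  qed
qed

lemma differentiable_reval:
  assumes "\<And>x. x \<in> S \<Longrightarrow> rdefined x t"
  shows "(\<lambda>x. reval x t) differentiable_on S"
  using assms
proof (induction t)
  case (RVar i)
  have "bounded_linear (\<lambda>x::complex^'a. x $ i)" by (rule bounded_linear_vec_nth)
  then show ?case
    by (auto intro: linear_imp_differentiable_on bounded_linear.linear)
next
  case (RInv s)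
  then have "(\<lambda>x. reval x s) differentiable_on S" by auto
  then show ?case
    using RInv.prems unfolding differentiable_on_def differentiable_def
    by simp (metis Deriv.has_derivative_inverse)
qed (auto intro!: derivative_intros)

lemma AE_generic:
  "AE \<tau> :: complex ^ 'i in lebesgue.
     \<forall>X. finite X \<and> (\<forall>i. \<tau> $ i \<in> fgen X) \<longrightarrow> CARD('i) \<le> card X"
proof -
  \<comment> \<open>Fewer than \<open>CARD('i)\<close> generators fit into a point of the hyperplane \<open>x $ i0 = 0\<close>, whose
    images under the countably many tuples of rational functions are negligible.\<close>
  fix i0 :: 'i
  define S where "S t = {x. x $ i0 = 0 \<and> (\<forall>i. rdefined x (t i))}" for t :: "'i \<Rightarrow> 'i rexp"
  define f where "f t x = (\<chi> i. reval x (t i))" for t :: "'i \<Rightarrow> 'i rexp" and x :: "complex ^ 'i"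
  have cnt: "countable (UNIV :: ('i \<Rightarrow> 'i rexp) set)" by simp
  have neg: "negligible (f t ` S t)" for t
  proof (rule negligible_differentiable_image_negligible)
    have "negligible {x :: complex ^ 'i. axis i0 1 \<bullet> x = 0}"
      by (rule negligible_hyperplane) (simp add: axis_eq_0_iff)
    then show "negligible (S t)"
      by (rule negligible_subset) (auto simp: S_def inner_axis')
    have f_sum: "f t = (\<lambda>x. \<Sum>i\<in>UNIV. axis i (reval x (t i)))"
      by (auto simp: f_def fun_eq_iff vec_eq_iff axis_def)
    have "(\<lambda>x. reval x (t i)) differentiable_on S t" for i
      by (rule differentiable_reval) (simp add: S_def)
    moreover have "linear (axis i :: complex \<Rightarrow> complex ^ 'i)" for i
      by (intro linearI) (auto simp: vec_eq_iff axis_def)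
    ultimately have "(\<lambda>x. axis i (reval x (t i))) differentiable_on S t" for i
      by (rule differentiable_on_compose[OF _ linear_imp_differentiable_on])
    then show "f t differentiable_on S t"
      unfolding f_sum by (auto simp: differentiable_on_def intro: differentiable_sum)
  qed simp
  have "negligible (\<Union>(range (\<lambda>t. f t ` S t)))"
    using neg cnt by (intro negligible_countable_Union) auto
  then have "AE \<tau> in lebesgue. \<tau> \<notin> (\<Union>(range (\<lambda>t. f t ` S t)))"
    unfolding negligible_iff_null_sets by (rule AE_not_in)
  then show ?thesis
  proof (rule AE_mp, intro AE_I2 impI allI)
    fix \<tau> :: "complex ^ 'i" and X :: "complex set"
    assume \<tau>: "\<tau> \<notin> (\<Union>(range (\<lambda>t. f t ` S t)))" and X: "finite X \<and> (\<forall>i. \<tau> $ i \<in> fgen X)"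
    show "CARD('i) \<le> card X"
    proof (rule ccontr)
      assume "\<not> CARD('i) \<le> card X"
      then have "card X \<le> card (UNIV - {i0})" by (simp add: card_Diff_singleton)
      with X obtain g where g: "g ` X \<subseteq> UNIV - {i0}" "inj_on g X"
        by (meson card_le_inj finite)
      \<comment> \<open>The generators are stored in distinct coordinates other than
        \<open>i0\<close>, and 0 fills the rest; so \<open>x\<close> lies on the hyperplane and
        every element of \<open>X\<close> is one of its coordinates.\<close>
      define x where "x = (\<chi> i. if i \<in> g ` X then inv_into X g i else 0)"
      have x0: "x $ i0 = 0" using g by (auto simp: x_def)
      have "b = x $ (g b)" if "b \<in> X" for b
        using that g by (simp add: x_def)
      then have sub: "X \<subseteq> range (($) x)" by auto
      have "\<exists>t. rdefined x t \<and> reval x t = \<tau> $ i" for i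
        by (rule fgen_imp_reval[OF _ sub]) (use X in auto)
      then obtain t where t: "\<And>i. rdefined x (t i) \<and> reval x (t i) = \<tau> $ i" by metis
      then have "x \<in> S t" "f t x = \<tau>" using x0 by (auto simp: S_def f_def vec_eq_iff)
      then show False using \<tau> by blast
    qed
  qed
qed

subsection \<open>Counting parameters\<close>

text \<open>Gaussian elimination never leaves the field of the coefficients. \<open>I\<close> holds
  the free variables, and the columns of \<open>c\<close> are the fundamental solutions; the
  identity block on \<open>I\<close> makes them independent solutions.\<close>

lemma linear_system_over_fgen:
  fixes r :: "'k \<Rightarrow> 'b \<Rightarrow> complex"
  assumes "finite B" "finite K" "\<And>k b. k \<in> K \<Longrightarrow> b \<in> B \<Longrightarrow> r k b \<in> fgen X"
  shows "\<exists>I c. I \<subseteq> B \<and> (\<forall>b\<in>B. \<forall>i\<in>I. c b i \<in> fgen X)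
      \<and> (\<forall>b\<in>I. \<forall>i\<in>I. c b i = (if b = i then 1 else 0))
      \<and> (\<forall>\<beta>. (\<forall>k\<in>K. (\<Sum>b\<in>B. \<beta> b * r k b) = 0) \<longleftrightarrow> (\<forall>b\<in>B. \<beta> b = (\<Sum>i\<in>I. c b i * \<beta> i)))"
proof -
  define solved where "solved K I c \<longleftrightarrow> I \<subseteq> B \<and> (\<forall>b\<in>B. \<forall>i\<in>I. c b i \<in> fgen X)
      \<and> (\<forall>b\<in>I. \<forall>i\<in>I. c b i = (if b = i then 1 else 0))
      \<and> (\<forall>\<beta>. (\<forall>k\<in>K. (\<Sum>b\<in>B. \<beta> b * r k b) = 0) \<longleftrightarrow> (\<forall>b\<in>B. \<beta> b = (\<Sum>i\<in>I. c b i * \<beta> i)))"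
    for K :: "'k set" and I :: "'b set" and c :: "'b \<Rightarrow> 'b \<Rightarrow> complex"
  have "\<exists>I c. solved K I c"
    using assms(2,3)
  proof (induction K rule: finite_induct)
    case empty
    show ?case unfolding solved_def
    proof (intro exI[of _ B] exI[of _ "\<lambda>b i. if b = i then 1 else 0"] conjI allI)
      fix \<beta> :: "'b \<Rightarrow> complex"
      have "(\<Sum>i\<in>B. (if b = i then 1 else 0) * \<beta> i) = \<beta> b" if "b \<in> B" for b
        using that assms(1) by (simp add: if_distrib if_distribR sum.delta cong: if_cong)
      then show "(\<forall>k\<in>{}. (\<Sum>b\<in>B. \<beta> b * r k b) = 0)
          \<longleftrightarrow> (\<forall>b\<in>B. \<beta> b = (\<Sum>i\<in>B. (if b = i then 1 else 0) * \<beta> i))" by simp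
    qed (auto intro: fgen_one fgen_zero)
  next
    case (insert k K)
    then obtain I c where Ic: "solved K I c" by auto
    have I: "I \<subseteq> B" and cX: "\<And>b i. b \<in> B \<Longrightarrow> i \<in> I \<Longrightarrow> c b i \<in> fgen X"
      and c1: "\<And>b i. b \<in> I \<Longrightarrow> i \<in> I \<Longrightarrow> c b i = (if b = i then 1 else 0)"
      and sol: "\<And>\<beta>. (\<forall>k\<in>K. (\<Sum>b\<in>B. \<beta> b * r k b) = 0) \<longleftrightarrow> (\<forall>b\<in>B. \<beta> b = (\<Sum>i\<in>I. c b i * \<beta> i))"
      using Ic unfolding solved_def by simp_all
    have finI: "finite I" using I assms(1) finite_subset by blast
    \<comment> \<open>Coefficients of the new equation after substituting the solution of the old
      ones; only free variables remain.\<close>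
    define d where "d i = (\<Sum>b\<in>B. c b i * r k b)" for i
    have dX: "d i \<in> fgen X" if "i \<in> I" for i
      unfolding d_def using that cX insert.prems by (intro fgen_sum fgen_mult) auto
    have eq: "(\<Sum>b\<in>B. \<beta> b * r k b) = (\<Sum>i\<in>I. d i * \<beta> i)"
      if "\<forall>b\<in>B. \<beta> b = (\<Sum>i\<in>I. c b i * \<beta> i)" for \<beta>
    proof -
      have "(\<Sum>b\<in>B. \<beta> b * r k b) = (\<Sum>b\<in>B. (\<Sum>i\<in>I. c b i * \<beta> i) * r k b)"
        using that by (intro sum.cong) auto
      also have "\<dots> = (\<Sum>b\<in>B. \<Sum>i\<in>I. c b i * r k b * \<beta> i)"
        unfolding sum_distrib_right by (intro sum.cong refl) (simp add: mult_ac)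
      also have "\<dots> = (\<Sum>i\<in>I. \<Sum>b\<in>B. c b i * r k b * \<beta> i)"
        by (rule sum.swap)
      finally show ?thesis by (simp add: d_def sum_distrib_right)
    qed
    show ?case
    proof (cases "\<forall>i\<in>I. d i = 0")
      case True
      have "(\<forall>k\<in>insert k K. (\<Sum>b\<in>B. \<beta> b * r k b) = 0) \<longleftrightarrow> (\<forall>b\<in>B. \<beta> b = (\<Sum>i\<in>I. c b i * \<beta> i))" for \<beta>
        using sol[of \<beta>] eq[of \<beta>] True by auto
      then have "solved (insert k K) I c" using I cX c1 unfolding solved_def by simp
      then show ?thesis by blast
    next
      case False
      then obtain m where m: "m \<in> I" "d m \<noteq> 0" by blast
      \<comment> \<open>\<open>m\<close> is the pivot: the new equation is solved for \<beta>
        \<open>m\<close>, and substituting the result turns \<open>c\<close> into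
        \<open>c'\<close>.\<close>
      define J where "J = I - {m}"
      define c' where "c' b i = c b i - c b m * (d i / d m)" for b i
      have split: "(\<Sum>i\<in>I. f i) = f m + (\<Sum>i\<in>J. f i)" for f :: "'b \<Rightarrow> complex"
        using finI m by (simp add: J_def sum.remove)
      have ex: "(\<Sum>i\<in>J. c' b i * \<beta> i) = (\<Sum>i\<in>J. c b i * \<beta> i) - c b m * ((\<Sum>i\<in>J. d i * \<beta> i) / d m)" for b \<beta>
          unfolding sum_divide_distrib sum_distrib_left sum_subtractf[symmetric]
          by (intro sum.cong refl) (simp add: c'_def algebra_simps)
      show ?thesis unfolding solved_def
      proof (intro exI[of _ J] exI[of _ c'] conjI ballI allI)
        show "J \<subseteq> B" using I by (auto simp: J_def)
        show "c' b i \<in> fgen X" if "b \<in> B" "i \<in> J" for b i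
          using that m unfolding c'_def J_def
          by (intro fgen_diff fgen_mult fgen_divide cX dX) auto
        show "c' b i = (if b = i then 1 else 0)" if "b \<in> J" "i \<in> J" for b i
          using that m c1 by (auto simp: c'_def J_def)
      next
        fix \<beta> :: "'b \<Rightarrow> complex"
        have m': "\<beta> m = - ((\<Sum>i\<in>J. d i * \<beta> i) / d m) \<longleftrightarrow> (\<Sum>i\<in>I. d i * \<beta> i) = 0"
          unfolding split using m by (auto simp: field_simps add_eq_0_iff)
        show "(\<forall>k\<in>insert k K. (\<Sum>b\<in>B. \<beta> b * r k b) = 0) \<longleftrightarrow> (\<forall>b\<in>B. \<beta> b = (\<Sum>i\<in>J. c' b i * \<beta> i))"
          (is "?L \<longleftrightarrow> ?R")
        proof
          assume L: ?L
          then have S: "\<forall>b\<in>B. \<beta> b = (\<Sum>i\<in>I. c b i * \<beta> i)" using sol[of \<beta>] by auto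
          with eq[OF this] L have "\<beta> m = - ((\<Sum>i\<in>J. d i * \<beta> i) / d m)" unfolding m' by auto
          then show ?R unfolding ex using S by (simp add: split)
        next
          assume R: ?R
          \<comment> \<open>By the identity block, row \<open>m\<close> of \<open>c'\<close> is
            \<open>- d i / d m\<close>, so the instance \<open>b = m\<close> of \<open>?R\<close> is
            the new equation solved for the pivot.\<close>
          have "c m m = 1" "\<And>i. i \<in> J \<Longrightarrow> c m i = 0" using c1 m by (auto simp: J_def)
          moreover have "\<beta> m = (\<Sum>i\<in>J. c' m i * \<beta> i)" using R m I by blast
          ultimately have mm: "\<beta> m = - ((\<Sum>i\<in>J. d i * \<beta> i) / d m)"
            unfolding ex by simp
          then have S: "\<forall>b\<in>B. \<beta> b = (\<Sum>i\<in>I. c b i * \<beta> i)"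
            using R unfolding ex by (simp add: split)
          then show ?L using sol[of \<beta>] eq[OF S] mm m' by auto
        qed
      qed
    qed
  qed
  then show ?thesis by (simp only: solved_def)
qed

text \<open>Passes from indexed families to sets of vectors: a repetition would give a relation with
  coefficients 1 and -1.\<close>

lemma independent_family_vec:
  fixes g :: "'b \<Rightarrow> complex ^ 'n"
  assumes "finite I" and 0: "\<And>\<alpha>. (\<Sum>i\<in>I. \<alpha> i *s g i) = 0 \<Longrightarrow> \<forall>i\<in>I. \<alpha> i = 0"
  shows "inj_on g I" "vec.independent (g ` I)"
proof -
  show inj: "inj_on g I"
  proof (rule inj_onI, rule ccontr)
    fix x y assume xy: "x \<in> I" "y \<in> I" "g x = g y" "x \<noteq> y"
    define c :: "'b \<Rightarrow> complex" where "c = (\<lambda>l. if l = x then 1 else if l = y then -1 else 0)"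
    have "(\<Sum>i\<in>I. c i *s g i) = (\<Sum>i\<in>{x,y}. c i *s g i)"
      using xy assms(1) by (intro sum.mono_neutral_right) (auto simp: c_def)
    also have "\<dots> = 0" using xy by (simp add: c_def)
    finally have "c x = 0" using 0 xy by blast
    then show False by (simp add: c_def)
  qed
  show "vec.independent (g ` I)"
  proof
    assume "vec.dependent (g ` I)"
    then obtain u where u: "\<exists>v\<in>g ` I. u v \<noteq> 0" "(\<Sum>v\<in>g ` I. u v *s v) = 0"
      using vec.dependent_finite[of "g ` I"] assms(1) by auto
    then have "(\<Sum>i\<in>I. u (g i) *s g i) = 0" by (simp add: sum.reindex[OF inj])
    from 0[of "\<lambda>i. u (g i)", OF this] u(1) show False by blast
  qed
qed

text \<open>
  The generators are the entries of the basis vectors up to one scaling per receiver, the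
  free coordinates of the \<^term>\<open>z j l\<close> up to one scaling per transmitter, and all but one
  coefficient for each pair on which the alignment equation is nontrivial.
\<close>
lemma generic_alignment_count:
  fixes \<tau> :: "'k::finite \<Rightarrow> 'k \<Rightarrow> 'l::finite \<Rightarrow> complex" and z :: "'k \<Rightarrow> 'l \<Rightarrow> complex ^ 'k"
    and B :: "(complex ^ 'k) set" and J :: "'k set"
  defines "supp \<equiv> \<lambda>j. {k. \<exists>l. z j l $ k \<noteq> 0}"
  assumes gen: "\<And>X. finite X \<Longrightarrow> (\<And>k j l. \<tau> k j l \<in> fgen X) \<Longrightarrow> CARD('k) * (CARD('k) * CARD('l)) \<le> card X"
    and ind: "vec.independent B" and ne: "J \<noteq> {}"
    and sp: "\<And>j l. j \<in> J \<Longrightarrow> z j l \<in> vec.span B"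
    and al: "\<And>k j. j \<in> J \<Longrightarrow> k \<noteq> j \<Longrightarrow> (\<Sum>l\<in>UNIV. \<tau> k j l * z j l $ k) = 0"
    and diag: "\<And>j. j \<in> J \<Longrightarrow> j \<in> supp j"
  shows "(\<Sum>j\<in>J. card (supp j)) < (\<Sum>b\<in>B. card {k. b $ k \<noteq> 0})
           + (\<Sum>j\<in>J. CARD('l) * vec.dim {h \<in> vec.span B. \<forall>k. k \<notin> supp j \<longrightarrow> h $ k = 0})"
proof -
  define q where "q j = vec.dim {h \<in> vec.span B. \<forall>k. k \<notin> supp j \<longrightarrow> h $ k = 0}" for j
  have finB: "finite B" using ind by (rule vec.finiteI_independent)
  define R where "R = {k. \<exists>b\<in>B. b $ k \<noteq> 0}"
  have "\<forall>k\<in>R. \<exists>b. b \<in> B \<and> b $ k \<noteq> 0" by (auto simp: R_def)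
  \<comment> \<open>\<open>a k\<close> is a basis vector used to normalise receiver
    \<open>k\<close>: row \<open>k\<close> is divided by its entry. The alignment equations at
    \<open>k\<close> are homogeneous, so this loses nothing and saves one generator per receiver in
    \<open>R\<close>.\<close>
  then obtain a where a: "\<And>k. k \<in> R \<Longrightarrow> a k \<in> B \<and> a k $ k \<noteq> 0" by metis
  define r where "r k b = b $ k / a k $ k" for k b
  define S where "S k = {b \<in> B. b $ k \<noteq> 0}" for k
  define X0 where "X0 = (\<Union>k\<in>R. r k ` (S k - {a k}))"
  have S: "finite (S k)" "k \<in> R \<Longrightarrow> a k \<in> S k" for k using finB a by (auto simp: S_def)
  have cardX0: "card X0 + card R \<le> (\<Sum>k\<in>R. card (S k))"
  proof -
    have "card X0 \<le> (\<Sum>k\<in>R. card (S k - {a k}))"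
      unfolding X0_def using S by (intro order.trans[OF card_UN_le] sum_mono card_image_le) auto
    moreover have "(\<Sum>k\<in>R. card (S k)) = (\<Sum>k\<in>R. card (S k - {a k}) + 1)"
    proof (rule sum.cong[OF refl])
      fix k assume "k \<in> R"
      with S[of k] have "card (S k) > 0" by (auto simp: card_gt_0_iff)
      with S(2)[OF \<open>k \<in> R\<close>] show "card (S k) = card (S k - {a k}) + 1" by simp
    qed
    ultimately show ?thesis by (simp only: sum.distrib) simp
  qed
  have rX: "r k b \<in> fgen X0" if "k \<in> R" "b \<in> B" for k b
  proof (cases "b \<in> S k - {a k}")
    case True
    then show ?thesis using that by (auto simp: X0_def intro: fgen_base)
  next
    case False
    then have "b $ k = 0 \<or> b = a k" using that by (auto simp: S_def)
    then show ?thesis using a[OF that(1)] by (auto simp: r_def intro: fgen_zero fgen_one)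
  qed
  have "\<forall>j l. \<exists>u. j \<in> J \<longrightarrow> z j l = (\<Sum>b\<in>B. u b *s b)"
    using sp vec.span_finite[OF finB] by blast
  then obtain \<beta> where \<beta>: "\<And>j l. j \<in> J \<Longrightarrow> z j l = (\<Sum>b\<in>B. \<beta> j l b *s b)" by metis
  have zk: "z j l $ k = a k $ k * (\<Sum>b\<in>B. \<beta> j l b * r k b)" if "j \<in> J" "k \<in> R" for j l k
    using that a[of k] by (simp add: \<beta> r_def sum_distrib_left)
  have suppR: "supp j \<subseteq> R" if "j \<in> J" for j
  proof
    fix k assume "k \<in> supp j"
    then obtain l where "z j l $ k \<noteq> 0" by (auto simp: supp_def)
    then have "(\<Sum>b\<in>B. \<beta> j l b * b $ k) \<noteq> 0" using that by (simp add: \<beta>)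
    then obtain b where "b \<in> B" "\<beta> j l b * b $ k \<noteq> 0" by (meson sum.not_neutral_contains_not_neutral)
    then show "k \<in> R" by (auto simp: R_def)
  qed
  \<comment> \<open>The vectors \<open>z j l\<close> of one transmitter vanish outside
    \<open>supp j\<close>. These linear conditions have coefficients in \<open>fgen X0\<close>, so
    at most \<open>q j\<close> coordinates of each vector are free.\<close>
  define reduced where "reduced j I c \<longleftrightarrow> I \<subseteq> B \<and> card I \<le> q j \<and> (\<forall>b\<in>B. \<forall>i\<in>I. c b i \<in> fgen X0)
      \<and> (\<forall>l. \<forall>b\<in>B. \<beta> j l b = (\<Sum>i\<in>I. c b i * \<beta> j l i))"
    for j and I :: "(complex ^ 'k) set" and c :: "complex ^ 'k \<Rightarrow> complex ^ 'k \<Rightarrow> complex"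
  have "\<exists>I c. reduced j I c" if j: "j \<in> J" for j
  proof -
    have rX': "r k b \<in> fgen X0" if "k \<in> R - supp j" "b \<in> B" for k b using rX that by simp
    from linear_system_over_fgen[OF finB finite rX']
    obtain I where "\<exists>c. I \<subseteq> B \<and> (\<forall>b\<in>B. \<forall>i\<in>I. c b i \<in> fgen X0)
      \<and> (\<forall>b\<in>I. \<forall>i\<in>I. c b i = (if b = i then 1 else 0))
      \<and> (\<forall>\<beta>. (\<forall>k\<in>R - supp j. (\<Sum>b\<in>B. \<beta> b * r k b) = 0) \<longleftrightarrow> (\<forall>b\<in>B. \<beta> b = (\<Sum>i\<in>I. c b i * \<beta> i)))" ..
    then obtain c where Ic: "I \<subseteq> B \<and> (\<forall>b\<in>B. \<forall>i\<in>I. c b i \<in> fgen X0)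
      \<and> (\<forall>b\<in>I. \<forall>i\<in>I. c b i = (if b = i then 1 else 0))
      \<and> (\<forall>\<beta>. (\<forall>k\<in>R - supp j. (\<Sum>b\<in>B. \<beta> b * r k b) = 0) \<longleftrightarrow> (\<forall>b\<in>B. \<beta> b = (\<Sum>i\<in>I. c b i * \<beta> i)))" ..
    note I = Ic[THEN conjunct1]
    have cX: "c b i \<in> fgen X0" if "b \<in> B" "i \<in> I" for b i
      using Ic[THEN conjunct2, THEN conjunct1] that by blast
    have c1: "c b i = (if b = i then 1 else 0)" if "b \<in> I" "i \<in> I" for b i
      using Ic[THEN conjunct2, THEN conjunct2, THEN conjunct1] that by blast
    note sol = Ic[THEN conjunct2, THEN conjunct2, THEN conjunct2, THEN spec]
    have finI: "finite I" using I finB finite_subset by blast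
    \<comment> \<open>The fundamental solutions as vectors. They are independent and supported in
      \<open>supp j\<close>, so their number is bounded by the dimension \<open>q j\<close>.\<close>
    define g where "g i = (\<Sum>b\<in>B. c b i *s b)" for i
    have comb: "(\<Sum>i\<in>I. c b i * c i m) = c b m" if "m \<in> I" for b m
    proof -
      have "(\<Sum>i\<in>I. c b i * c i m) = (\<Sum>i\<in>I. if i = m then c b i else 0)"
        using c1 that by (intro sum.cong) auto
      then show ?thesis using finI that by simp
    qed
    have g_in: "g m \<in> {h \<in> vec.span B. \<forall>k. k \<notin> supp j \<longrightarrow> h $ k = 0}" if m: "m \<in> I" for m
    proof (intro CollectI conjI allI impI)
      show "g m \<in> vec.span B"
        unfolding g_def by (intro vec.span_sum vec.span_scale vec.span_base)
      fix k assume k: "k \<notin> supp j"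
      have gk: "g m $ k = (\<Sum>b\<in>B. c b m * b $ k)" by (simp add: g_def)
      show "g m $ k = 0"
      proof (cases "k \<in> R")
        case True
        have "\<forall>b\<in>B. c b m = (\<Sum>i\<in>I. c b i * c i m)"
          using comb[OF m, symmetric] by blast
        with sol[of "\<lambda>b. c b m"] have "\<forall>k\<in>R - supp j. (\<Sum>b\<in>B. c b m * r k b) = 0"
          by (rule iffD2)
        then have "(\<Sum>b\<in>B. c b m * r k b) = 0" using True k by blast
        then show ?thesis using a[OF True] unfolding gk r_def
          by (simp add: sum_divide_distrib[symmetric])
      next
        case False
        then show ?thesis unfolding gk by (intro sum.neutral) (auto simp: R_def)
      qed
    qed
    have inj: "inj_on g I" and indg: "vec.independent (g ` I)"
    proof -
      have "\<forall>i\<in>I. \<alpha> i = 0" if "(\<Sum>i\<in>I. \<alpha> i *s g i) = 0" for \<alpha>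
      proof
        fix i assume i: "i \<in> I"
        have "(\<Sum>i\<in>I. \<alpha> i *s g i) = (\<Sum>i\<in>I. \<Sum>b\<in>B. (\<alpha> i * c b i) *s b)"
          by (simp add: g_def vec.scale_sum_right)
        also have "\<dots> = (\<Sum>b\<in>B. \<Sum>i\<in>I. (\<alpha> i * c b i) *s b)" by (rule sum.swap)
        also have "\<dots> = (\<Sum>b\<in>B. (\<Sum>i\<in>I. \<alpha> i * c b i) *s b)"
          by (simp add: vec.scale_sum_left)
        finally have "(\<Sum>b\<in>B. (\<Sum>i\<in>I. \<alpha> i * c b i) *s b) = 0" using that by simp
        then have "(\<Sum>m\<in>I. \<alpha> m * c i m) = 0"
          using vec.independentD[OF ind finB subset_refl, of "\<lambda>b. \<Sum>m\<in>I. \<alpha> m * c b m" i] i I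
          by (simp add: subset_iff)
        also have "(\<Sum>m\<in>I. \<alpha> m * c i m) = (\<Sum>m\<in>I. if m = i then \<alpha> m else 0)"
          using c1 i by (intro sum.cong) auto
        finally show "\<alpha> i = 0" using i finI by simp
      qed
      from independent_family_vec[of I g, OF finI this]
      show "inj_on g I" "vec.independent (g ` I)" by auto
    qed
    have "g ` I \<subseteq> {h \<in> vec.span B. \<forall>k. k \<notin> supp j \<longrightarrow> h $ k = 0}"
      by (rule image_subsetI) (rule g_in)
    from vec.independent_card_le_dim[OF this indg] have cardI: "card I \<le> q j"
      by (simp add: q_def card_image[OF inj])
    have red: "\<forall>b\<in>B. \<beta> j l b = (\<Sum>i\<in>I. c b i * \<beta> j l i)" for l
    proof -
      have "(\<Sum>b\<in>B. \<beta> j l b * r k b) = 0" if "k \<in> R - supp j" for k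
        using that zk[OF j, of k l] a[of k] by (auto simp: supp_def)
      then have "\<forall>k\<in>R - supp j. (\<Sum>b\<in>B. \<beta> j l b * r k b) = 0" ..
      with sol[of "\<beta> j l"] show ?thesis by (rule iffD1)
    qed
    have "reduced j I c"
      unfolding reduced_def by (intro conjI ballI allI I cardI cX red[rule_format])
    then show ?thesis by blast
  qed
  then obtain I c where Ic: "\<And>j. j \<in> J \<Longrightarrow> reduced j (I j) (c j)" by metis
  have I: "\<And>j. j \<in> J \<Longrightarrow> I j \<subseteq> B" "\<And>j. j \<in> J \<Longrightarrow> card (I j) \<le> q j"
    and c: "\<And>j b i. j \<in> J \<Longrightarrow> b \<in> B \<Longrightarrow> i \<in> I j \<Longrightarrow> c j b i \<in> fgen X0"
    and sol: "\<And>j l b. j \<in> J \<Longrightarrow> b \<in> B \<Longrightarrow> \<beta> j l b = (\<Sum>i\<in>I j. c j b i * \<beta> j l i)"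
    using Ic unfolding reduced_def by blast+
  have finI: "finite (I j)" if "j \<in> J" for j using I(1)[OF that] finB finite_subset by blast
  \<comment> \<open>\<open>z j l\<close> is nonzero at receiver \<open>j\<close> for some
    \<open>l\<close>, so not all free coordinates vanish. A nonzero one is scaled to 1, which saves
    one generator per transmitter.\<close>
  have "\<exists>l i. i \<in> I j \<and> \<beta> j l i \<noteq> 0" if j: "j \<in> J" for j
  proof -
    obtain l where l: "z j l $ j \<noteq> 0" using diag[OF j] by (auto simp: supp_def)
    have "\<exists>i\<in>I j. \<beta> j l i \<noteq> 0"
    proof (rule ccontr)
      assume "\<not> ?thesis"
      then have "\<beta> j l b = 0" if "b \<in> B" for b using sol[OF j that, of l] by simp
      with l show False by (simp add: \<beta>[OF j])
    qed
    then show ?thesis by blast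
  qed
  then obtain l1 i1 where l1: "\<And>j. j \<in> J \<Longrightarrow> i1 j \<in> I j" "\<And>j. j \<in> J \<Longrightarrow> \<beta> j (l1 j) (i1 j) \<noteq> 0"
    by metis
  define s where "s j = \<beta> j (l1 j) (i1 j)" for j
  have s0: "s j \<noteq> 0" if "j \<in> J" for j using l1 that by (simp add: s_def)
  define Q where "Q j = (UNIV :: 'l set) \<times> I j" for j
  define X1 where "X1 = (\<Union>j\<in>J. (\<lambda>(l, i). \<beta> j l i / s j) ` (Q j - {(l1 j, i1 j)}))"
  have Q: "finite (Q j)" "(l1 j, i1 j) \<in> Q j" "card (Q j) \<le> CARD('l) * q j" if "j \<in> J" for j
    using that finI l1 I(2) by (auto simp: Q_def card_cartesian_product)
  have cardX1: "card X1 + card J \<le> (\<Sum>j\<in>J. CARD('l) * q j)"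
  proof -
    have "card X1 \<le> (\<Sum>j\<in>J. card (Q j - {(l1 j, i1 j)}))"
      unfolding X1_def using Q(1) by (intro order.trans[OF card_UN_le] sum_mono card_image_le) auto
    moreover have "(\<Sum>j\<in>J. card (Q j - {(l1 j, i1 j)}) + 1) \<le> (\<Sum>j\<in>J. CARD('l) * q j)"
    proof (rule sum_mono)
      fix j assume j: "j \<in> J"
      then have "card (Q j) > 0" using Q[OF j] by (auto simp: card_gt_0_iff)
      with Q[OF j] show "card (Q j - {(l1 j, i1 j)}) + 1 \<le> CARD('l) * q j"
        by simp
    qed
    ultimately show ?thesis by (simp only: sum.distrib) simp
  qed
  have "\<forall>k j. \<exists>l. k \<in> supp j \<longrightarrow> z j l $ k \<noteq> 0" by (auto simp: supp_def)
  then obtain l0 where l0: "\<And>k j. k \<in> supp j \<Longrightarrow> z j (l0 k j) $ k \<noteq> 0" by metis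
  \<comment> \<open>One coefficient for each pair with a nontrivial alignment equation, chosen with
    nonzero factor \<open>z j (l0 k j) $ k\<close>. The pair \<open>k = j\<close> carries no
    equation; this loss of \<open>card J\<close> is exactly made up by the scalings in
    \<open>X1\<close>.\<close>
  define D where "D = (\<lambda>(j, k). (k, j, l0 k j)) ` (SIGMA j:J. supp j - {j})"
  define X2 where "X2 = (\<lambda>(k, j, l). \<tau> k j l) ` (UNIV - D)"
  have cardD: "card D + card J = (\<Sum>j\<in>J. card (supp j))"
  proof -
    have "card D = card (SIGMA j:J. supp j - {j})"
      unfolding D_def by (intro card_image) (auto simp: inj_on_def)
    also have "\<dots> = (\<Sum>j\<in>J. card (supp j - {j}))" by (subst card_SigmaI) auto
    also have "\<dots> + card J = (\<Sum>j\<in>J. card (supp j - {j}) + 1)" by (simp only: sum.distrib) simp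
    also have "\<dots> = (\<Sum>j\<in>J. card (supp j))"
      using diag by (intro sum.cong refl) (metis Suc_eq_plus1 card_Suc_Diff1 finite)
    finally show ?thesis .
  qed
  have cardX2: "card X2 + card D \<le> CARD('k) * (CARD('k) * CARD('l))"
  proof -
    have "card X2 \<le> card (UNIV - D)" unfolding X2_def by (rule card_image_le) simp
    also have "card (UNIV - D) + card D = CARD('k \<times> 'k \<times> 'l)"
      by (metis card_Diff_subset card_mono finite le_add_diff_inverse2 subset_UNIV)
    finally show ?thesis by simp
  qed
  define X where "X = X0 \<union> X1 \<union> X2"
  have finX: "finite X"
    using finI S(1) by (auto simp: X_def X0_def X1_def X2_def Q_def)
  have ndX: "\<tau> k j l \<in> fgen X" if "(k, j, l) \<notin> D" for k j l
    using that by (intro fgen_base) (force simp: X_def X2_def)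
  have X0X: "x \<in> fgen X" if "x \<in> fgen X0" for x
    using that fgen_mono[of X0 X] by (auto simp: X_def)
  have \<beta>X: "\<beta> j l b / s j \<in> fgen X" if j: "j \<in> J" and b: "b \<in> B" for j l b
  proof -
    have "\<beta> j l i / s j \<in> fgen X" if "i \<in> I j" for i
    proof (cases "(l, i) = (l1 j, i1 j)")
      case True
      then show ?thesis using s0[OF j] by (auto simp: s_def intro: fgen_one)
    next
      case False
      then have "\<beta> j l i / s j \<in> X"
        using that j by (force simp: X_def X1_def Q_def)
      then show ?thesis by (rule fgen_base)
    qed
    then have "(\<Sum>i\<in>I j. c j b i * (\<beta> j l i / s j)) \<in> fgen X"
      using X0X[OF c[OF j b]] by (intro fgen_sum fgen_mult) auto
    then show ?thesis by (subst sol[OF j b]) (simp add: sum_divide_distrib)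
  qed
  have "\<tau> k j l \<in> fgen X" for k j l
  proof (cases "(k, j, l) \<in> D")
    case False
    then show ?thesis by (rule ndX)
  next
    case True
    then have j: "j \<in> J" and k: "k \<in> supp j" "k \<noteq> j" and l: "l = l0 k j" by (auto simp: D_def)
    have kR: "k \<in> R" using suppR j k by blast
    \<comment> \<open>The entries of \<open>z j m\<close> at \<open>k\<close> with both scalings
      divided out; unlike the entries themselves, these lie in \<open>fgen X\<close>.\<close>
    define w where "w m = (\<Sum>b\<in>B. \<beta> j m b / s j * r k b)" for m
    have wX: "w m \<in> fgen X" for m
      unfolding w_def using j kR by (intro fgen_sum fgen_mult \<beta>X X0X rX)
    have zw: "z j m $ k = a k $ k * s j * w m" for m
      using zk[OF j kR, of m] s0[OF j] by (simp add: w_def sum_divide_distrib[symmetric])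
    have "(\<Sum>m\<in>UNIV. \<tau> k j m * z j m $ k) = a k $ k * s j * (\<Sum>m\<in>UNIV. \<tau> k j m * w m)"
      by (simp add: zw sum_distrib_left mult_ac)
    then have "(\<Sum>m\<in>UNIV. \<tau> k j m * w m) = 0"
      using al[OF j k(2)] a[OF kR] s0[OF j] by simp
    then have "\<tau> k j l * w l + (\<Sum>m\<in>UNIV - {l}. \<tau> k j m * w m) = 0"
      by (subst (asm) sum.remove[of _ l]) auto
    moreover have "w l \<noteq> 0" using l0[OF k(1)] l zw[of l] by auto
    ultimately have "\<tau> k j l = - (\<Sum>m\<in>UNIV - {l}. \<tau> k j m * w m) / w l"
      by (simp add: field_simps add_eq_0_iff)
    \<comment> \<open>\<open>D\<close> contains only one triple for the pair of \<open>j\<close> and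
      \<open>k\<close>, so the other coefficients of this equation are generators.\<close>
    moreover have "\<tau> k j m \<in> fgen X" if "m \<noteq> l" for m
      using that l by (intro ndX) (auto simp: D_def)
    ultimately show ?thesis
      using wX by (auto intro!: fgen_divide fgen_uminus fgen_sum fgen_mult)
  qed
  then have "CARD('k) * (CARD('k) * CARD('l)) \<le> card X" by (rule gen[OF finX])
  also have "card X \<le> card X0 + card X1 + card X2"
    unfolding X_def by (meson add_right_mono card_Un_le order.trans)
  finally have main: "CARD('k) * (CARD('k) * CARD('l)) \<le> card X0 + card X1 + card X2" .
  \<comment> \<open>The normalisation of at least one receiver makes the final inequality
    strict.\<close>
  have "R \<noteq> {}" using ne diag suppR by blast
  then have "card R > 0" by (simp add: card_gt_0_iff)
  \<comment> \<open>Double counting of the nonzero entries of the basis, by receivers and by basis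
    vectors.\<close>
  have "(\<Sum>k\<in>R. card (S k)) \<le> (\<Sum>k\<in>UNIV. card (S k))" by (intro sum_mono2) auto
  also have "\<dots> = (\<Sum>k\<in>UNIV. \<Sum>b\<in>B. of_bool (b $ k \<noteq> 0))"
    using finB by (simp add: S_def Int_def)
  also have "\<dots> = (\<Sum>b\<in>B. \<Sum>k\<in>UNIV. of_bool (b $ k \<noteq> 0))" by (rule sum.swap)
  also have "\<dots> = (\<Sum>b\<in>B. card {k. b $ k \<noteq> 0})" by simp
  finally show ?thesis
    using cardX0 cardX1 cardX2 cardD main \<open>card R > 0\<close> unfolding q_def by linarith
qed

subsection \<open>Dense sets of users\<close>

text \<open>A maximiser of \<open>f - g\<close>, written additively because subtraction of naturals
  truncates.\<close>

lemma finite_has_argmax_diff: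
  fixes f g :: "'a \<Rightarrow> nat"
  assumes "finite S" "S \<noteq> {}"
  shows "\<exists>x\<in>S. \<forall>y\<in>S. f y + g x \<le> f x + g y"
proof -
  define d where "d x = int (f x) - int (g x)" for x
  have "Max (d ` S) \<in> d ` S" using assms by (intro Max_in) auto
  then obtain x where x: "x \<in> S" "d x = Max (d ` S)" by auto
  have "f y + g x \<le> f x + g y" if "y \<in> S" for y
  proof -
    have "d y \<le> d x" unfolding x(2) using that assms(1) by (intro Max_ge) auto
    then show ?thesis unfolding d_def by linarith
  qed
  then show ?thesis using x(1) by blast
qed

text \<open>The layer-cake formula: each \<open>s\<close> is counted once at every level from 1 to
  \<open>f s\<close>.\<close>

lemma sum_eq_sum_card_ge:
  fixes f :: "'a \<Rightarrow> nat"
  assumes "finite S" "\<And>s. s \<in> S \<Longrightarrow> f s \<le> M"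
  shows "(\<Sum>s\<in>S. f s) = (\<Sum>x = 1..M. card {s \<in> S. x \<le> f s})"
proof -
  have "(\<Sum>x = 1..M. card {s \<in> S. x \<le> f s}) = (\<Sum>x = 1..M. \<Sum>s\<in>S. of_bool (x \<le> f s))"
    using assms(1) by (simp add: Int_def)
  also have "\<dots> = (\<Sum>s\<in>S. \<Sum>x = 1..M. of_bool (x \<le> f s))" by (rule sum.swap)
  also have "\<dots> = (\<Sum>s\<in>S. f s)"
  proof (rule sum.cong[OF refl])
    fix s assume "s \<in> S"
    then have "{1..M} \<inter> {x. x \<le> f s} = {1..f s}" using assms(2)[of s] by auto
    then show "(\<Sum>x = 1..M. of_bool (x \<le> f s)) = f s" by simp
  qed
  finally show ?thesis by simp
qed

text \<open>Rank-nullity for an arbitrary set \<open>S\<close>: extend a basis of the kernel part to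
  one of \<open>S\<close>; the images of the added vectors span the image. Equality can fail when
  \<open>S\<close> is not a subspace.\<close>

lemma dim_kernel_plus_dim_image_le:
  fixes f :: "complex ^ 'n \<Rightarrow> complex ^ 'm"
  assumes f: "Vector_Spaces.linear (*s) (*s) f"
  shows "vec.dim {x \<in> S. f x = 0} + vec.dim (f ` S) \<le> vec.dim S"
proof -
  interpret f: Vector_Spaces.linear "(*s)" "(*s)" f by (rule f)
  obtain C where C: "C \<subseteq> {x \<in> S. f x = 0}" "vec.independent C"
    "card C = vec.dim {x \<in> S. f x = 0}"
    by (rule vec.basis_exists)
  have "C \<subseteq> S" using C(1) by blast
  then obtain D where D: "C \<subseteq> D" "D \<subseteq> S" "vec.independent D" "S \<subseteq> vec.span D"
    by (rule vec.maximal_independent_subset_extend[OF _ C(2)])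
  have finD: "finite D" using D(3) by (rule vec.finiteI_independent)
  have "f ` S \<subseteq> vec.span (f ` D)"
    using image_mono[OF D(4), of f] by (simp only: f.span_image)
  also have "\<dots> \<subseteq> vec.span (f ` (D - C))"
  proof (rule vec.span_minimal)
    show "f ` D \<subseteq> vec.span (f ` (D - C))"
    proof
      fix y assume "y \<in> f ` D"
      then obtain x where x: "x \<in> D" "y = f x" by blast
      show "y \<in> vec.span (f ` (D - C))"
      proof (cases "x \<in> C")
        case True
        then have "y = 0" using C(1) x by auto
        then show ?thesis by (simp add: vec.span_zero)
      next
        case False
        then show ?thesis using x by (intro vec.span_base) auto
      qed
    qed
  qed (rule vec.subspace_span)
  finally have "vec.dim (f ` S) \<le> card (f ` (D - C))"
    using finD by (intro vec.dim_le_card) auto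
  also have "\<dots> \<le> card (D - C)" using finD by (intro card_image_le) auto
  finally have "card C + vec.dim (f ` S) \<le> card C + card (D - C)" by simp
  also have "\<dots> = card D" using card_Diff_subset[OF finite_subset[OF D(1) finD] D(1)] card_mono[OF finD D(1)] by simp
  also have "\<dots> = vec.dim S" using D by (intro vec.basis_card_eq_dim) auto
  finally show ?thesis using C(3) by simp
qed

text \<open>Greedy choice: a basis taken from \<open>V n\<close> is extended by elements of
  \<open>V (Suc n)\<close>. The sets need not be subspaces, so the basis can consist of prescribed
  vectors, here the \<open>z j l\<close>.\<close>

lemma filtration_basis:
  fixes V :: "nat \<Rightarrow> (complex ^ 'n) set"
  assumes mono: "\<And>x y. x \<le> y \<Longrightarrow> V x \<subseteq> V y"
  shows "\<exists>B. B \<subseteq> V n \<and> vec.independent B \<and> V n \<subseteq> vec.span B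
    \<and> (\<forall>x\<le>n. card {b \<in> B. b \<notin> V x} + vec.dim (V x) \<le> vec.dim (V n))"
proof (induction n)
  case 0
  obtain B where B: "B \<subseteq> V 0" "vec.independent B" "V 0 \<subseteq> vec.span B"
    by (rule vec.maximal_independent_subset)
  have "{b \<in> B. b \<notin> V 0} = {}" using B(1) by blast
  then have "card {b \<in> B. b \<notin> V 0} = 0" by (simp only: card.empty)
  with B show ?case by (intro exI[of _ B]) auto
next
  case (Suc n)
  then obtain B where B: "B \<subseteq> V n" "vec.independent B" "V n \<subseteq> vec.span B"
    "\<And>x. x \<le> n \<Longrightarrow> card {b \<in> B. b \<notin> V x} + vec.dim (V x) \<le> vec.dim (V n)" by blast
  have "B \<subseteq> V (Suc n)" using B(1) mono[of n "Suc n"] by auto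
  then obtain B' where B': "B \<subseteq> B'" "B' \<subseteq> V (Suc n)" "vec.independent B'" "V (Suc n) \<subseteq> vec.span B'"
    by (rule vec.maximal_independent_subset_extend[OF _ B(2)])
  have finB': "finite B'" using B'(3) by (rule vec.finiteI_independent)
  then have cd: "card (B' - B) + card B = card B'"
    using card_Diff_subset[OF finite_subset[OF B'(1)] B'(1)] card_mono[OF _ B'(1)] by simp
  have cB: "card B = vec.dim (V n)" using B by (intro vec.basis_card_eq_dim)
  have cB': "card B' = vec.dim (V (Suc n))" using B' by (intro vec.basis_card_eq_dim)
  have "card {b \<in> B'. b \<notin> V x} + vec.dim (V x) \<le> vec.dim (V (Suc n))" if "x \<le> Suc n" for x
  proof (cases "x = Suc n")
    case True
    then have "{b \<in> B'. b \<notin> V x} = {}" using B'(2) by blast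
    then have "card {b \<in> B'. b \<notin> V x} = 0" by (simp only: card.empty)
    then show ?thesis using True by simp
  next
    case False
    then have "x \<le> n" using that by simp
    have "card {b \<in> B'. b \<notin> V x} \<le> card ({b \<in> B. b \<notin> V x} \<union> (B' - B))"
      using finB' B'(1) by (intro card_mono) (auto intro: finite_subset)
    also have "\<dots> \<le> card {b \<in> B. b \<notin> V x} + card (B' - B)" by (rule card_Un_le)
    finally show ?thesis using B(4)[OF \<open>x \<le> n\<close>] cd cB cB' by linarith
  qed
  with B' show ?case by blast
qed

text \<open>Otherwise \<open>p * N\<close> \<le> \<open>CARD('k)\<close>. Density then makes the
  total excess \<gamma> over \<open>J\<close> at least the total support size of a greedy basis,
  whereas \<open>generic_alignment_count\<close> makes it strictly smaller.\<close>

lemma generic_alignment_bound: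
  fixes \<tau> :: "'k::finite \<Rightarrow> 'k \<Rightarrow> 'l::finite \<Rightarrow> complex" and y :: "'k \<Rightarrow> 'l \<Rightarrow> complex ^ 'k"
    and W :: "(complex ^ 'k) set"
  assumes gen: "\<And>X. finite X \<Longrightarrow> (\<And>k j l. \<tau> k j l \<in> fgen X) \<Longrightarrow> CARD('k) * (CARD('k) * CARD('l)) \<le> card X"
    and W: "vec.subspace W" "vec.dim W \<le> N" "\<And>j l. y j l \<in> W"
    and al: "\<And>k j. k \<noteq> j \<Longrightarrow> (\<Sum>l\<in>UNIV. \<tau> k j l * y j l $ k) = 0"
    and diag: "\<And>j. \<exists>l. y j l $ j \<noteq> 0"
  shows "CARD('k) < (CARD('l) + 1) * N"
proof (rule ccontr)
  define p where "p = CARD('l) + 1"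
  assume "\<not> ?thesis"
  then have big: "p * N \<le> CARD('k)" by (simp add: p_def)
  define rs where "rs R h = (\<chi> k. if k \<in> R then h $ k else 0)" for R :: "'k set" and h :: "complex ^ 'k"
  have lin: "Vector_Spaces.linear (*s) (*s) (rs R)" for R
    by (unfold_locales) (auto simp: rs_def vec_eq_iff algebra_simps)
  have sub: "vec.subspace (rs R ` W)" for R
    using vec.linear_subspace_image[OF lin W(1)] .
  have rs_rs: "rs R (rs R' h) = rs (R \<inter> R') h" for R R' h
    by (auto simp: rs_def vec_eq_iff)
  define \<rho> where "\<rho> R = vec.dim (rs R ` W)" for R
  have \<rho>0: "\<rho> {} = 0"
  proof -
    have "rs {} ` W \<subseteq> {0}" by (auto simp: rs_def vec_eq_iff)
    then show ?thesis unfolding \<rho>_def by simp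
  qed
  \<comment> \<open>Densest receivers: \<open>R\<close> maximises \<open>card R\<close> minus
    \<open>p\<close> times the rank of the restriction to \<open>R\<close>. Comparison with
    \<open>UNIV\<close> shows that the maximum is nonnegative.\<close>
  obtain R where Rne: "R \<noteq> {}"
    and Rmax: "\<And>R'. R' \<noteq> {} \<Longrightarrow> card R' + p * \<rho> R \<le> card R + p * \<rho> R'"
    using finite_has_argmax_diff[of "Pow (UNIV :: 'k set) - {{}}" card "\<lambda>R. p * \<rho> R"] by auto
  have "rs UNIV ` W = W" by (auto simp: rs_def)
  then have "p * \<rho> UNIV \<le> CARD('k)"
    unfolding \<rho>_def using order.trans[OF mult_le_mono2[OF W(2), of p] big] by simp
  with Rmax[of UNIV] have R0: "p * \<rho> R \<le> card R" by simp
  \<comment> \<open>Vectors supported in \<open>O'\<close> form the kernel of restriction to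
    \<open>R - O'\<close>, so their dimension is at most the drop in rank, which maximality of
    \<open>R\<close> bounds. If \<open>R - O'\<close> is empty, \<open>R0\<close> replaces
    maximality.\<close>
  have dense: "p * vec.dim {h \<in> rs R ` W. \<forall>k. k \<notin> O' \<longrightarrow> h $ k = 0} \<le> card O'" if "O' \<subseteq> R" for O'
  proof -
    have "{h \<in> rs R ` W. \<forall>k. k \<notin> O' \<longrightarrow> h $ k = 0} = {h \<in> rs R ` W. rs (R - O') h = 0}"
      using that by (auto simp: rs_def vec_eq_iff)
    moreover have "rs (R - O') ` (rs R ` W) = rs (R - O') ` W"
      unfolding image_image rs_rs by (intro image_cong refl) (simp add: Int_absorb2)
    ultimately have "vec.dim {h \<in> rs R ` W. \<forall>k. k \<notin> O' \<longrightarrow> h $ k = 0} + \<rho> (R - O') \<le> \<rho> R"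
      using dim_kernel_plus_dim_image_le[OF lin, of "rs R ` W" "R - O'"] by (simp add: \<rho>_def)
    from mult_le_mono2[OF this, of p]
    have "p * vec.dim {h \<in> rs R ` W. \<forall>k. k \<notin> O' \<longrightarrow> h $ k = 0} + p * \<rho> (R - O') \<le> p * \<rho> R"
      unfolding add_mult_distrib2 .
    moreover have "card (R - O') + p * \<rho> R \<le> card R + p * \<rho> (R - O')"
    proof (cases "R - O' = {}")
      case True
      show ?thesis unfolding True using R0 by simp
    next
      case False
      then show ?thesis using Rmax[of "R - O'"] by simp
    qed
    moreover have "card (R - O') + card O' = card R"
      using that by (metis card_Diff_subset card_mono finite le_add_diff_inverse2)
    ultimately show ?thesis by linarith
  qed
  define z where "z j l = rs R (y j l)" for j l
  have zR: "z j l $ k = (if k \<in> R then y j l $ k else 0)" for j l k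
    by (simp add: z_def rs_def)
  define Z where "Z J = (\<Union>j\<in>J. range (z j))" for J
  have ZR: "vec.span (Z J) \<subseteq> rs R ` W" for J
    using W(3) by (intro vec.span_minimal sub) (auto simp: Z_def z_def)
  have "Pow R - {{}} \<noteq> {}" using Rne by blast
  then obtain J where J: "J \<subseteq> R" "J \<noteq> {}"
    and Jmax: "\<And>J'. J' \<subseteq> R \<Longrightarrow> J' \<noteq> {} \<Longrightarrow> card J' + p * vec.dim (Z J) \<le> card J + p * vec.dim (Z J')"
    using finite_has_argmax_diff[of "Pow R - {{}}" card "\<lambda>J. p * vec.dim (Z J)"] by auto
  have "Z R \<subseteq> rs R ` W" using ZR[of R] vec.span_superset by blast
  then have "p * vec.dim (Z R) \<le> p * \<rho> R" by (auto simp: \<rho>_def intro: vec.dim_subset)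
  with Jmax[OF subset_refl Rne] R0 have J0: "p * vec.dim (Z J) \<le> card J" by linarith
  have Jdense: "card J' + p * vec.dim (Z J) \<le> card J + p * vec.dim (Z J')" if "J' \<subseteq> J" for J'
  proof (cases "J' = {}")
    case True
    then show ?thesis using J0 by simp
  next
    case False
    then show ?thesis using Jmax[of J'] that J by auto
  qed
  define supp where "supp j = {k. \<exists>l. z j l $ k \<noteq> 0}" for j
  have suppR: "supp j \<subseteq> R" for j by (auto simp: supp_def zR)
  define q where "q j = vec.dim {h \<in> vec.span (Z J). \<forall>k. k \<notin> supp j \<longrightarrow> h $ k = 0}" for j
  have pq: "p * q j \<le> card (supp j)" for j
  proof -
    have "q j \<le> vec.dim {h \<in> rs R ` W. \<forall>k. k \<notin> supp j \<longrightarrow> h $ k = 0}"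
      unfolding q_def using ZR by (intro vec.dim_subset) auto
    then show ?thesis using dense[OF suppR[of j]] by (meson mult_le_mono2 order.trans)
  qed
  \<comment> \<open>\<open>\<gamma> j\<close> is the excess of equations over parameters contributed by transmitter \<open>j\<close>.\<close>
  define \<gamma> where "\<gamma> j = card (supp j) - CARD('l) * q j" for j
  have Lq: "CARD('l) * q j \<le> card (supp j)" for j
    using pq[of j] by (simp add: p_def)
  \<comment> \<open>With \<open>p = CARD('l) + 1\<close>, the bound \<open>pq\<close> leaves at
    least the fraction \<open>1 / p\<close> of the support as excess.\<close>
  have supp_\<gamma>: "card (supp j) \<le> p * \<gamma> j" for j
  proof -
    have "p * (CARD('l) * q j) \<le> CARD('l) * card (supp j)"
      using mult_le_mono2[OF pq[of j], of "CARD('l)"] by (simp add: mult_ac)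
    moreover have "p * \<gamma> j = p * card (supp j) - p * (CARD('l) * q j)"
      by (simp add: \<gamma>_def diff_mult_distrib2)
    moreover have "p * card (supp j) = CARD('l) * card (supp j) + card (supp j)"
      by (simp add: p_def)
    ultimately show ?thesis by linarith
  qed
  \<comment> \<open>Filtration by excess: greedy extension along it prefers transmitters of small
    excess, hence of small support.\<close>
  define V where "V x = Z {j \<in> J. \<gamma> j < x}" for x
  define n where "n = CARD('k) + 1"
  have \<gamma>n: "\<gamma> j < n" for j
    using card_mono[of UNIV "supp j"] by (simp add: \<gamma>_def n_def)
  then have Vn: "V n = Z J" by (simp add: V_def)
  have mono_V: "V x \<subseteq> V x'" if "x \<le> x'" for x x' using that by (auto simp: V_def Z_def)
  from filtration_basis[of V n, OF mono_V] obtain B where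
    "B \<subseteq> V n \<and> vec.independent B \<and> V n \<subseteq> vec.span B
      \<and> (\<forall>x\<le>n. card {b \<in> B. b \<notin> V x} + vec.dim (V x) \<le> vec.dim (V n))" ..
  then have B: "B \<subseteq> V n" "vec.independent B" "V n \<subseteq> vec.span B"
    and Bx: "\<forall>x\<le>n. card {b \<in> B. b \<notin> V x} + vec.dim (V x) \<le> vec.dim (V n)"
    by simp_all
  have finB: "finite B" using B(2) by (rule vec.finiteI_independent)
  have spB: "vec.span B = vec.span (Z J)"
    using vec.span_mono[OF B(1)[unfolded Vn]] vec.span_minimal[OF B(3)[unfolded Vn] vec.subspace_span]
    by (rule antisym)
  \<comment> \<open>The smallest excess of a transmitter in \<open>J\<close> that produces
    \<open>b\<close>; \<open>Suc\<close> compensates for the strict inequality in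
    \<open>V\<close>.\<close>
  define g where "g b = (LEAST x. b \<in> V (Suc x))" for b
  have gV: "b \<in> V (Suc (g b))" "g b < n" if "b \<in> B" for b
  proof -
    have "b \<in> V (Suc (n - 1))" using that B(1) by (auto simp: n_def)
    then show "b \<in> V (Suc (g b))" unfolding g_def by (rule LeastI)
    have "g b \<le> n - 1" unfolding g_def using \<open>b \<in> V (Suc (n - 1))\<close> by (rule Least_le)
    then show "g b < n" by (simp add: n_def)
  qed
  have notV: "b \<notin> V x" if "x \<le> g b" for b x
  proof (cases x)
    case 0
    then show ?thesis by (simp add: V_def Z_def)
  next
    case (Suc x')
    then show ?thesis using that not_less_Least[of x' "\<lambda>x. b \<in> V (Suc x)"] by (simp add: g_def)
  qed
  have supp_g: "card {k. b $ k \<noteq> 0} \<le> p * g b" if b: "b \<in> B" for b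
  proof -
    obtain j l where j: "j \<in> J" "\<gamma> j \<le> g b" "b = z j l"
      using gV(1)[OF b] unfolding V_def Z_def by (auto simp: less_Suc_eq_le)
    have "card {k. b $ k \<noteq> 0} \<le> card (supp j)"
      using j(3) by (intro card_mono) (auto simp: supp_def)
    also have "\<dots> \<le> p * \<gamma> j" by (rule supp_\<gamma>)
    also have "\<dots> \<le> p * g b" using j(2) by simp
    finally show ?thesis .
  qed
  \<comment> \<open>The greedy basis takes at most one element of excess \<open>\<ge> x\<close> per \<open>p\<close> transmitters of excess \<open>\<ge> x\<close>.\<close>
  have "p * (\<Sum>b\<in>B. g b) = (\<Sum>x = 1..n. p * card {b \<in> B. x \<le> g b})"
    using finB gV(2) by (subst sum_eq_sum_card_ge[of B g n]) (auto simp: sum_distrib_left less_imp_le)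
  also have "\<dots> \<le> (\<Sum>x = 1..n. card {j \<in> J. x \<le> \<gamma> j})"
  proof (rule sum_mono)
    fix x assume "x \<in> {1..n}"
    then have "card {b \<in> B. b \<notin> V x} + vec.dim (V x) \<le> vec.dim (Z J)" using Bx Vn by simp
    moreover have "card {b \<in> B. x \<le> g b} \<le> card {b \<in> B. b \<notin> V x}"
      using finB notV by (intro card_mono) auto
    ultimately have "card {b \<in> B. x \<le> g b} + vec.dim (V x) \<le> vec.dim (Z J)" by simp
    from mult_le_mono2[OF this, of p]
    have "p * card {b \<in> B. x \<le> g b} + p * vec.dim (V x) \<le> p * vec.dim (Z J)"
      unfolding add_mult_distrib2 .
    \<comment> \<open>Maximality of \<open>J\<close> against its part below level \<open>x\<close>:
      passing from \<open>V x\<close> to \<open>Z J\<close> gains at most one dimension per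
      \<open>p\<close> further transmitters.\<close>
    moreover have "card {j \<in> J. \<gamma> j < x} + p * vec.dim (Z J) \<le> card J + p * vec.dim (V x)"
      unfolding V_def by (rule Jdense) auto
    moreover have "card J = card {j \<in> J. \<gamma> j < x} + card {j \<in> J. x \<le> \<gamma> j}"
      by (subst card_Un_disjoint[symmetric]) (auto intro!: arg_cong[where f = card])
    ultimately show "p * card {b \<in> B. x \<le> g b} \<le> card {j \<in> J. x \<le> \<gamma> j}" by linarith
  qed
  also have "\<dots> = (\<Sum>j\<in>J. \<gamma> j)"
    using \<gamma>n by (intro sum_eq_sum_card_ge[symmetric]) (auto simp: less_imp_le)
  finally have "p * (\<Sum>b\<in>B. g b) \<le> (\<Sum>j\<in>J. \<gamma> j)" .
  moreover have "(\<Sum>b\<in>B. card {k. b $ k \<noteq> 0}) \<le> p * (\<Sum>b\<in>B. g b)"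
    unfolding sum_distrib_left by (intro sum_mono supp_g)
  moreover have "(\<Sum>j\<in>J. card (supp j)) = (\<Sum>j\<in>J. \<gamma> j) + (\<Sum>j\<in>J. CARD('l) * q j)"
    unfolding sum.distrib[symmetric] using Lq by (intro sum.cong) (auto simp: \<gamma>_def)
  moreover have "(\<Sum>j\<in>J. card (supp j)) < (\<Sum>b\<in>B. card {k. b $ k \<noteq> 0}) + (\<Sum>j\<in>J. CARD('l) * q j)"
    unfolding supp_def q_def spB[symmetric]
  proof (rule generic_alignment_count[OF gen B(2) J(2)])
    show "z j l \<in> vec.span B" if "j \<in> J" for j l
      using that unfolding spB by (intro vec.span_base) (auto simp: Z_def)
    show "(\<Sum>l\<in>UNIV. \<tau> k j l * z j l $ k) = 0" if "k \<noteq> j" for k j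
      using al[OF that] by (cases "k \<in> R") (simp_all add: zR)
    show "j \<in> {k. \<exists>l. z j l $ k \<noteq> 0}" if "j \<in> J" for j
      using that J(1) diag[of j] by (auto simp: zR)
  qed
  ultimately show False by linarith
qed

section \<open>From the interference channel to generic alignment\<close>

lemma channel_form_eq_sum:
  "herm_prod u (channel A \<tau> k j *v v) = (\<Sum>l\<in>UNIV. \<tau> $ (k, j, l) * herm_prod u (A l *v v))"
proof -
  have "channel A \<tau> k j *v v = (\<Sum>l\<in>UNIV. \<tau> $ (k, j, l) *s (A l *v v))"
    by (simp add: channel_def lin_comb_def mat_scale_def vec_eq_iff matrix_vector_mult_def
        sum_distrib_left sum_distrib_right mult_ac) (auto intro: sum.swap)
  then show ?thesis
    by (simp add: herm_prod_def sum_distrib_left mult_ac) (auto intro: sum.swap)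
qed

text \<open>\<open>generic_alignment_bound\<close> is applied twice, the second time with
  transmitters and receivers exchanged; alignment and genericity are symmetric under this
  exchange.\<close>

lemma IA_users_less:
  fixes A :: "'l::finite \<Rightarrow> complex ^ 'nt ^ 'nr" and \<tau> :: "complex ^ ('k::finite \<times> 'k \<times> 'l)"
  assumes gen: "\<And>X. finite X \<Longrightarrow> (\<And>k j l. \<tau> $ (k, j, l) \<in> fgen X) \<Longrightarrow> CARD('k) * (CARD('k) * CARD('l)) \<le> card X"
    and ia: "IA_achievable (channel A \<tau>)"
  shows "CARD('k) < (CARD('l) + 1) * CARD('nr)" "CARD('k) < (CARD('l) + 1) * CARD('nt)"
proof -
  obtain v :: "'k \<Rightarrow> complex ^ 'nt" and u :: "'k \<Rightarrow> complex ^ 'nr" where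
    al: "\<And>k j. k \<noteq> j \<Longrightarrow> herm_prod (u k) (channel A \<tau> k j *v v j) = 0"
    and diag: "\<And>k. herm_prod (u k) (channel A \<tau> k k *v v k) \<noteq> 0"
    using ia unfolding IA_achievable_def by blast
  define y where "y k j l = herm_prod (u k) (A l *v v j)" for k j l
  have al': "(\<Sum>l\<in>UNIV. \<tau> $ (k, j, l) * y k j l) = 0" if "k \<noteq> j" for k j
    using al[OF that] by (simp add: channel_form_eq_sum y_def)
  have diag': "\<exists>l. y k k l \<noteq> 0" for k
    using diag[of k] by (auto simp: channel_form_eq_sum y_def dest: sum.not_neutral_contains_not_neutral)
  \<comment> \<open>The conjugated receive vectors are the rows, so \<open>U\<close> maps a received
    signal to its products with all \<open>u k\<close>, and its range has dimension at most
    \<open>CARD('nr)\<close>.\<close>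
  define U where "U = (\<chi> k i. cnj (u k $ i))"
  define V where "V = (\<chi> k i. v k $ i)"
  show "CARD('k) < (CARD('l) + 1) * CARD('nr)"
  proof (rule generic_alignment_bound[where \<tau> = "\<lambda>k j l. \<tau> $ (k, j, l)" and W = "range ((*v) U)"
        and y = "\<lambda>j l. U *v (A l *v v j)"])
    show "CARD('k) * (CARD('k) * CARD('l)) \<le> card X"
      if "finite X" "\<And>k j l. \<tau> $ (k, j, l) \<in> fgen X" for X
      using that by (rule gen)
    show "vec.subspace (range ((*v) U))"
      by (rule vec.linear_subspace_image[OF matrix_vector_mul_linear_gen vec.subspace_UNIV])
    show "vec.dim (range ((*v) U)) \<le> CARD('nr)"
      using vec.dim_image_le[OF matrix_vector_mul_linear_gen, of U UNIV] by (simp add: vec.dim_UNIV card_cart_basis)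
    have Uy: "(U *v (A l *v v j)) $ k = y k j l" for k j l
      by (simp add: U_def y_def herm_prod_def matrix_vector_mult_def)
    show "(\<Sum>l\<in>UNIV. \<tau> $ (k, j, l) * (U *v (A l *v v j)) $ k) = 0" if "k \<noteq> j" for k j
      using al'[OF that] by (simp add: Uy)
    show "\<exists>l. (U *v (A l *v v j)) $ j \<noteq> 0" for j using diag'[of j] by (simp add: Uy)
  qed auto
  show "CARD('k) < (CARD('l) + 1) * CARD('nt)"
  \<comment> \<open>Reciprocal channel: the vector fed to \<open>V\<close> is the row vector formed
    by the conjugate of \<open>u j\<close> times \<open>A l\<close>, so entry \<open>k\<close> of
    the result is \<open>y j k l\<close>.\<close>
  proof (rule generic_alignment_bound[where \<tau> = "\<lambda>k j l. \<tau> $ (j, k, l)" and W = "range ((*v) V)"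
        and y = "\<lambda>j l. V *v (\<chi> i. \<Sum>m\<in>UNIV. cnj (u j $ m) * A l $ m $ i)"])
    show "CARD('k) * (CARD('k) * CARD('l)) \<le> card X"
      if "finite X" "\<And>k j l. \<tau> $ (j, k, l) \<in> fgen X" for X
      using that by (rule gen)
    show "vec.subspace (range ((*v) V))"
      by (rule vec.linear_subspace_image[OF matrix_vector_mul_linear_gen vec.subspace_UNIV])
    show "vec.dim (range ((*v) V)) \<le> CARD('nt)"
      using vec.dim_image_le[OF matrix_vector_mul_linear_gen, of V UNIV] by (simp add: vec.dim_UNIV card_cart_basis)
    have Vy: "(V *v (\<chi> i. \<Sum>m\<in>UNIV. cnj (u j $ m) * A l $ m $ i)) $ k = y j k l" for k j l
      by (simp add: V_def y_def herm_prod_def matrix_vector_mult_def sum_distrib_left mult_ac)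
        (rule sum.swap)
    show "(\<Sum>l\<in>UNIV. \<tau> $ (j, k, l) * (V *v (\<chi> i. \<Sum>m\<in>UNIV. cnj (u j $ m) * A l $ m $ i)) $ k) = 0"
      if "k \<noteq> j" for k j
      using al'[OF that[symmetric]] by (simp only: Vy)
    show "\<exists>l. (V *v (\<chi> i. \<Sum>m\<in>UNIV. cnj (u j $ m) * A l $ m $ i)) $ j \<noteq> 0" for j
      using diag'[of j] by (simp only: Vy)
  qed auto
qed

theorem theorem3p2:
  fixes A :: "'l::finite \<Rightarrow> complex ^ 'nt ^ 'nr"
    and Mt Mr T K L Nt Nr N :: nat
  assumes "Mt > 0" "Mr > 0" "T > 0"
    and "Nt = Mt * T" "Nr = Mr * T" "N = min Nt Nr"
    and "CARD('nt) = Nt" "CARD('nr) = Nr"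
    and "CARD('k::finite) = K" "CARD('l) = L"
    and "lin_indep_family A"
    and "A \<in> Psi"
  shows "AE \<tau> :: complex ^ ('k \<times> 'k \<times> 'l) in lebesgue.
    IA_achievable (channel A \<tau>) \<longrightarrow> real K \<le> real N * real L + (real N)\<^sup>2 / 4"
  using AE_generic
proof (rule AE_mp, intro AE_I2 impI)
  fix \<tau> :: "complex ^ ('k \<times> 'k \<times> 'l)"
  assume gen: "\<forall>X. finite X \<and> (\<forall>i. \<tau> $ i \<in> fgen X) \<longrightarrow> CARD('k \<times> 'k \<times> 'l) \<le> card X"
    and ia: "IA_achievable (channel A \<tau>)"
  have gen': "CARD('k) * (CARD('k) * CARD('l)) \<le> card X"
    if "finite X" "\<And>k j l. \<tau> $ (k, j, l) \<in> fgen X" for X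
    using gen[rule_format, of X] that by simp
  have "K < (L + 1) * Nr" "K < (L + 1) * Nt"
    using IA_users_less[OF gen' ia] assms(7-10) by auto
  then have "K < (L + 1) * N" using assms(6) by (simp add: min_def)
  then have "K + 1 \<le> N * L + N" by (simp add: algebra_simps)
  then have "real K + 1 \<le> real N * real L + real N"
    by (metis of_nat_1 of_nat_add of_nat_le_iff of_nat_mult)
  \<comment> \<open>The square gives \<open>N - 1\<close> \<le> \<open>N^2 / 4\<close>, and the
    strict integer bound supplies the missing 1.\<close>
  moreover have "0 \<le> (real N / 2 - 1)\<^sup>2" by simp
  then have "real N - 1 \<le> (real N)\<^sup>2 / 4" by (simp add: power2_eq_square field_simps)
  ultimately show "real K \<le> real N * real L + (real N)\<^sup>2 / 4" by linarith
qed

end
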